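(* Let $m,n\ge 1$ be integers, let $P:[0,1]\to\mathbb{R}$ be continuous and nonnegative almost everywhere, let $\omega$ be a modulus of continuity, and let $\overline{x}=\{x_1,\dots,x_n\}$ with $0\le x_1<x_2<\dots<x_n\le 1$ be given. Put $$\Pi_i(\overline{x})=\Bigl\{x\in[0,1]:\ \min_{j=1,\dots,n}|x-x_j|=|x-x_i|\Bigr\},\qquad c_i^*(P,\overline{x})=\int_{\Pi_i(\overline{x})}P(x)\,dx,\quad i=1,\dots,n,$$ $$f_{\omega,\overline{x}}(x)=\omega\Bigl(\min_{i=1,\dots,n}|x-x_i|\Bigr),\quad x\in[0,1].$$ Then the method $$\Phi^*(f(x_1),\dots,f(x_n))=\mathrm{co}\Bigl(\sum_{k=1}^n c_k^*(P,\overline{x})\,f(x_k)\Bigr)$$ is an optimal method of recovery of the integral $\int_0^1P(x)f(x)\,dx$ on the class $H^\omega([0,1],K(\mathbb{R}^m))$ using the information $f(x_1),\dots,f(x_n)$, i.e. $R(H^\omega([0,1],K(\mathbb{R}^m)),\overline{x},\Phi^* )=R(H^\omega([0,1],K(\mathbb{R}^m)),\overline{x})$, and the optimal error of recovery is $$R(H^\omega([0,1],K(\mathbb{R}^m)),\overline{x})=\int_0^1P(x)f_{\omega,\overline{x}}(x)\,dx.$$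
   Context: $K(\mathbb{R}^m)$ is the set of nonempty compact subsets of $\mathbb{R}^m$, and $K^c(\mathbb{R}^m)$ is the set of its convex elements. For $A,B\in K(\mathbb{R}^m)$ and $\lambda,\mu\in\mathbb{R}$, $\lambda A+\mu B=\{\lambda a+\mu b:a\in A,\,b\in B\}$ (Minkowski combination); $\mathrm{co}\,A$ is the convex hull of $A$. With $\|\cdot\|$ the Euclidean norm, $d(a,B)=\inf_{b\in B}\|a-b\|$ and $d(A,B)=\sup_{a\in A}d(a,B)$, the Hausdorff metric on $K(\mathbb{R}^m)$ is $\delta(A,B)=\max\{d(A,B),d(B,A)\}$. Riemann–Minkowski integral: for $g:[0,1]\to K(\mathbb{R}^m)$, a partition $0=t_0<t_1<\dots<t_N=1$ and tags $\xi_i\in[t_{i-1},t_i]$, the Riemann–Minkowski sum is $\sum_{i=1}^N(t_i-t_{i-1})g(\xi_i)$. The function $g$ is integrable, with integral $\int_0^1g(x)\,dx=I\in K(\mathbb{R}^m)$, if the Riemann–Minkowski sums converge to $I$ in the metric $\delta$ as the mesh $\max_i(t_i-t_{i-1})$ tends to $0$. Integrals of set-valued functions are understood in this sense; continuous bounded functions are integrable. A modulus of continuity is, as usual, a continuous nondecreasing subadditive function $\omega:[0,\infty)\to[0,\infty)$ with $\omega(0)=0$. $H^\omega([0,1],K(\mathbb{R}^m))$ is the class of functions $f:[0,1]\to K(\mathbb{R}^m)$ such that $\delta(f(x'),f(x''))\le\omega(|x'-x''|)$ for all $x',x''\in[0,1]$. A method of recovery is an arbitrary mapping $\Phi:K(\mathbb{R}^m)^n\to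 K^c(\mathbb{R}^m)$. For a class $\mathcal{M}$ of integrable functions, $$R(\mathcal{M},\overline{x},\Phi)=\sup_{f\in\mathcal{M}}\delta\Bigl(\int_0^1P(x)f(x)\,dx,\ \Phi(f(x_1),\dots,f(x_n))\Bigr),\qquad R(\mathcal{M},\overline{x})=\inf_{\Phi}R(\mathcal{M},\overline{x},\Phi),$$ the infimum being over all methods $\Phi$. A method realizing this infimum is called optimal, and $R(\mathcal{M},\overline{x})$ is the optimal error of recovery. *)

theory Defs
  imports "HOL-Analysis.Analysis"
begin

definition compacts :: "'a::real_normed_vector set set"
  where "compacts = {A. compact A \<and> A \<noteq> {}}"

definition convex_compacts :: "'a::real_normed_vector set set"
  where "convex_compacts = {A \<in> compacts. convex A}"

definition excess :: "'a::real_normed_vector set \<Rightarrow> 'a set \<Rightarrow> real"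
  where "excess A B = (SUP a\<in>A. infdist a B)"

definition hausdorff :: "'a::real_normed_vector set \<Rightarrow> 'a set \<Rightarrow> real"
  where "hausdorff A B = max (excess A B) (excess B A)"

definition set_scale :: "real \<Rightarrow> 'a::real_normed_vector set \<Rightarrow> 'a set"  (infixr "\<bullet>\<^sub>S" 75)
  where "c \<bullet>\<^sub>S A = (\<lambda>a. c *\<^sub>R a) ` A"

text \<open>
  Sums of sets below are Minkowski sums: \<open>+\<close> and \<open>\<Sum>\<close> on sets are those of
  \<^theory>\<open>HOL-Library.Set_Algebras\<close>, whose zero is the singleton \<open>{0}\<close>.

  A tagged partition of the unit interval is \<open>0 = t 0 < t 1 < \<dots> < t N = 1\<close>; the tag \<open>\<xi> i\<close>
  belongs to the \<open>i\<close>-th interval counted from zero.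
\<close>

definition tagged_partition :: "nat \<Rightarrow> (nat \<Rightarrow> real) \<Rightarrow> (nat \<Rightarrow> real) \<Rightarrow> bool"
  where "tagged_partition N t \<xi> \<longleftrightarrow>
    t 0 = 0 \<and> t N = 1 \<and> (\<forall>i<N. t i < t (Suc i) \<and> \<xi> i \<in> {t i..t (Suc i)})"

definition mesh :: "nat \<Rightarrow> (nat \<Rightarrow> real) \<Rightarrow> real"
  where "mesh N t = (MAX i\<in>{..<N}. t (Suc i) - t i)"

definition RM_sum ::
    "(real \<Rightarrow> 'a::real_normed_vector set) \<Rightarrow> nat \<Rightarrow> (nat \<Rightarrow> real) \<Rightarrow> (nat \<Rightarrow> real) \<Rightarrow> 'a set"
  where "RM_sum g N t \<xi> = (\<Sum>i<N. (t (Suc i) - t i) \<bullet>\<^sub>S g (\<xi> i))"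

definition has_RM_integral :: "(real \<Rightarrow> 'a::real_normed_vector set) \<Rightarrow> 'a set \<Rightarrow> bool"
  where "has_RM_integral g I \<longleftrightarrow> I \<in> compacts \<and>
    (\<forall>\<epsilon>>0. \<exists>\<eta>>0. \<forall>N t \<xi>. tagged_partition N t \<xi> \<and> mesh N t < \<eta> \<longrightarrow>
      hausdorff (RM_sum g N t \<xi>) I < \<epsilon>)"

definition RM_integral :: "(real \<Rightarrow> 'a::real_normed_vector set) \<Rightarrow> 'a set"
  where "RM_integral g = (THE I. has_RM_integral g I)"

definition modulus_of_continuity :: "(real \<Rightarrow> real) \<Rightarrow> bool"
  where "modulus_of_continuity \<omega> \<longleftrightarrow>
    continuous_on {0..} \<omega> \<and> mono_on {0..} \<omega> \<and> \<omega> ` {0..} \<subseteq> {0..} \<and> \<omega> 0 = 0 \<and>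
    (\<forall>s\<ge>0. \<forall>t\<ge>0. \<omega> (s + t) \<le> \<omega> s + \<omega> t)"

text \<open>
  Functions on the unit interval are represented by functions on \<open>real\<close> whose values elsewhere
  are arbitrary; nothing below depends on those values.
\<close>

definition H_class :: "(real \<Rightarrow> real) \<Rightarrow> (real \<Rightarrow> 'a::real_normed_vector set) set"
  where "H_class \<omega> = {f \<in> {0..1} \<rightarrow> compacts.
    \<forall>x'\<in>{0..1}. \<forall>x''\<in>{0..1}. hausdorff (f x') (f x'') \<le> \<omega> \<bar>x' - x''\<bar>}"

text \<open>
  An \<open>n\<close>-tuple is an extensional function on \<open>{1..n}\<close>.  The error is extended-real valued,
  because the supremum may be infinite for an arbitrary method.
\<close>

definition methods :: "nat \<Rightarrow> ((nat \<Rightarrow> 'a::real_normed_vector set) \<Rightarrow> 'a set) set"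
  where "methods n = ({1..n} \<rightarrow>\<^sub>E compacts) \<rightarrow> convex_compacts"

definition recovery_error ::
    "(real \<Rightarrow> real) \<Rightarrow> (real \<Rightarrow> 'a::real_normed_vector set) set \<Rightarrow> nat \<Rightarrow> (nat \<Rightarrow> real) \<Rightarrow>
      ((nat \<Rightarrow> 'a set) \<Rightarrow> 'a set) \<Rightarrow> ereal"
  where "recovery_error P M n x \<Phi> =
    (SUP f\<in>M. ereal (hausdorff (RM_integral (\<lambda>s. P s \<bullet>\<^sub>S f s)) (\<Phi> (\<lambda>i\<in>{1..n}. f (x i)))))"

definition optimal_error ::
    "(real \<Rightarrow> real) \<Rightarrow> (real \<Rightarrow> 'a::real_normed_vector set) set \<Rightarrow> nat \<Rightarrow> (nat \<Rightarrow> real) \<Rightarrow> ereal"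
  where "optimal_error P M n x = (INF \<Phi>\<in>methods n. recovery_error P M n x \<Phi>)"

definition optimal_method ::
    "(real \<Rightarrow> real) \<Rightarrow> (real \<Rightarrow> 'a::real_normed_vector set) set \<Rightarrow> nat \<Rightarrow> (nat \<Rightarrow> real) \<Rightarrow>
      ((nat \<Rightarrow> 'a set) \<Rightarrow> 'a set) \<Rightarrow> bool"
  where "optimal_method P M n x \<Phi> \<longleftrightarrow>
    \<Phi> \<in> methods n \<and> recovery_error P M n x \<Phi> = optimal_error P M n x"

definition node_dist :: "nat \<Rightarrow> (nat \<Rightarrow> real) \<Rightarrow> real \<Rightarrow> real"
  where "node_dist n x s = (MIN j\<in>{1..n}. \<bar>s - x j\<bar>)"

definition cell :: "nat \<Rightarrow> (nat \<Rightarrow> real) \<Rightarrow> nat \<Rightarrow> real set"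
  where "cell n x i = {s \<in> {0..1}. node_dist n x s = \<bar>s - x i\<bar>}"

definition cell_weight :: "(real \<Rightarrow> real) \<Rightarrow> nat \<Rightarrow> (nat \<Rightarrow> real) \<Rightarrow> nat \<Rightarrow> real"
  where "cell_weight P n x i = integral (cell n x i) P"

definition cell_method ::
    "(real \<Rightarrow> real) \<Rightarrow> nat \<Rightarrow> (nat \<Rightarrow> real) \<Rightarrow> (nat \<Rightarrow> 'a::real_normed_vector set) \<Rightarrow> 'a set"
  where "cell_method P n x A = convex hull (\<Sum>k\<in>{1..n}. cell_weight P n x k \<bullet>\<^sub>S A k)"

end

theory Submission
  imports Defs
begin

text \<open>
  Everything is read off from support functions \<open>h\<^sub>A u = sup {u \<bullet> a | a \<in> A}\<close>.  They turn Minkowski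
  combinations with nonnegative coefficients into combinations of real functions, they ignore
  convex hulls, and on convex compact sets the Hausdorff distance is at most the maximal difference
  of the support functions over the unit sphere (\<open>hausdorff_le_if_support\<close>,
  \<open>abs_support_diff_le\<close>).

  The Riemann--Minkowski integral \<open>J\<close> of \<open>P f\<close> exists and is a convex set with
  \<open>h\<^sub>J u = \<integral> P(s) h\<^bsub>f(s)\<^esub> u ds\<close> (\<open>weighted_integral_support\<close>), although the values of \<open>f\<close> need not
  be convex.  Indeed, the support functions of the Riemann--Minkowski sums are ordinary Riemann sums
  and converge uniformly on the unit sphere, so the convex hulls of the sums converge to a convex
  set (\<open>uniform_limit_of_supports\<close>); and a sum of many small summands is close to its convex hull
  (\<open>Shapley_Folkman_Pythagoras\<close>).

  For the upper bound, the cells cover the unit interval up to overlaps in finitely many points, so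
  \<open>\<Sum> c\<^sub>k h\<^bsub>f(x\<^sub>k)\<^esub> u\<close> is the integral of the function equal to \<open>P(s) h\<^bsub>f(x\<^sub>k)\<^esub> u\<close> on the \<open>k\<close>-th cell; there
  it differs from \<open>P(s) h\<^bsub>f(s)\<^esub> u\<close> by at most \<open>P(s) \<omega>(\<bar>s - x\<^sub>k\<bar>)\<close>.  For the lower bound, the two
  singleton-valued functions \<open>{\<plusminus>\<omega>(min\<^sub>i \<bar>s - x\<^sub>i\<bar>) e}\<close>, with \<open>e\<close> a unit vector, belong to the class and
  take the value \<open>{0}\<close> at all nodes, but their integrals lie at twice the asserted error from each other.
\<close>

section \<open>Compact sets and the Hausdorff distance\<close>

lemma compacts_iff: "A \<in> compacts \<longleftrightarrow> compact A \<and> A \<noteq> {}"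
  by (simp add: compacts_def)

lemma compacts_plus:
  assumes "A \<in> compacts" "B \<in> compacts"
  shows "A + B \<in> compacts"
proof -
  have "A + B = {x + y | x y. x \<in> A \<and> y \<in> B}"
    by (auto simp: set_plus_def)
  then show ?thesis
    using assms compact_sums[of A B] by (auto simp: compacts_iff)
qed

lemma compacts_sum:
  assumes "\<And>i. i \<in> I \<Longrightarrow> A i \<in> compacts"
  shows "(\<Sum>i\<in>I. A i) \<in> compacts"
  using assms
proof (induction I rule: infinite_finite_induct)
  case (insert i I)
  then show ?case by (simp add: compacts_plus)
qed (auto simp: compacts_iff set_zero)

lemma compacts_scale: "A \<in> compacts \<Longrightarrow> c \<bullet>\<^sub>S A \<in> compacts"
  by (auto simp: compacts_iff set_scale_def compact_scaling)

lemma convex_compacts_hull: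
  fixes A :: "'a::euclidean_space set"
  shows "A \<in> compacts \<Longrightarrow> convex hull A \<in> convex_compacts"
  by (auto simp: convex_compacts_def compacts_iff compact_convex_hull)

lemma convex_compactsD:
  assumes "A \<in> convex_compacts"
  shows "A \<in> compacts" "convex A"
  using assms by (auto simp: convex_compacts_def)

lemma infdist_le_excess:
  assumes "A \<in> compacts" "a \<in> A"
  shows "infdist a B \<le> excess A B"
  unfolding excess_def
proof (rule cSUP_upper[OF assms(2)])
  have "compact ((\<lambda>a. infdist a B) ` A)"
    using assms by (intro compact_continuous_image continuous_intros) (auto simp: compacts_iff)
  then show "bdd_above ((\<lambda>a. infdist a B) ` A)"
    by (simp add: compact_imp_bounded bounded_imp_bdd_above)
qed

lemma hausdorff_leI:
  assumes "A \<in> compacts" "B \<in> compacts"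
    and "\<And>a. a \<in> A \<Longrightarrow> infdist a B \<le> c" "\<And>b. b \<in> B \<Longrightarrow> infdist b A \<le> c"
  shows "hausdorff A B \<le> c"
  using assms unfolding hausdorff_def excess_def compacts_iff
  by (auto intro!: cSUP_least)

lemma hausdorff_commute: "hausdorff A B = hausdorff B A"
  by (simp add: hausdorff_def max.commute)

lemma infdist_le_hausdorff:
  assumes "A \<in> compacts" "a \<in> A"
  shows "infdist a B \<le> hausdorff A B"
  using infdist_le_excess[OF assms, of B] by (simp add: hausdorff_def)

lemma hausdorff_nearest:
  fixes A B :: "'a::euclidean_space set"
  assumes "A \<in> compacts" "B \<in> compacts" "a \<in> A"
  obtains b where "b \<in> B" "dist a b \<le> hausdorff A B"
proof -
  obtain b where "b \<in> B" "infdist a B = dist a b"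
    using infdist_attains_inf[of B a] assms by (auto simp: compacts_iff compact_imp_closed)
  then show ?thesis
    using infdist_le_hausdorff[OF assms(1,3), of B] that by auto
qed

lemma hausdorff_triangle:
  fixes A B C :: "'a::euclidean_space set"
  assumes A: "A \<in> compacts" and B: "B \<in> compacts" and C: "C \<in> compacts"
  shows "hausdorff A C \<le> hausdorff A B + hausdorff B C"
proof (rule hausdorff_leI[OF A C])
  have step: "infdist a Z \<le> hausdorff X Y + hausdorff Y Z"
    if XYZ: "X \<in> compacts" "Y \<in> compacts" "Z \<in> compacts" and a: "a \<in> X"
    for a and X Y Z :: "'a set"
  proof -
    obtain b where b: "b \<in> Y" "dist a b \<le> hausdorff X Y"
      using hausdorff_nearest XYZ a by blast
    then show ?thesis
      using infdist_triangle[of a Z b] infdist_le_hausdorff[OF XYZ(2) b(1), of Z] by linarith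
  qed
  show "infdist a C \<le> hausdorff A B + hausdorff B C" if "a \<in> A" for a
    using step[OF A B C that] .
  show "infdist c A \<le> hausdorff A B + hausdorff B C" if "c \<in> C" for c
    using step[OF C B A that] by (simp add: hausdorff_commute)
qed

lemma hausdorff_le_0D:
  fixes A B :: "'a::euclidean_space set"
  assumes "A \<in> compacts" "B \<in> compacts" "hausdorff A B \<le> 0"
  shows "A = B"
proof -
  have "X \<subseteq> Y" if XY: "X \<in> compacts" "Y \<in> compacts" "hausdorff X Y \<le> 0" for X Y :: "'a set"
  proof
    fix a assume "a \<in> X"
    then obtain b where "b \<in> Y" "dist a b \<le> hausdorff X Y"
      using hausdorff_nearest XY by blast
    with XY(3) show "a \<in> Y"
      by (smt (verit) dist_le_zero_iff)
  qed
  with assms show ?thesis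
    by (metis hausdorff_commute subset_antisym)
qed

section \<open>Support functions\<close>

text \<open>The support function of a set, evaluated at \<open>u\<close>.\<close>

definition support :: "'a::euclidean_space set \<Rightarrow> 'a \<Rightarrow> real"
  where "support A u = (SUP a\<in>A. u \<bullet> a)"

lemma support_attained:
  assumes "A \<in> compacts"
  obtains a where "a \<in> A" "support A u = u \<bullet> a" "\<And>b. b \<in> A \<Longrightarrow> u \<bullet> b \<le> support A u"
proof -
  have "continuous_on A (\<lambda>a. u \<bullet> a)"
    by (intro continuous_intros)
  then obtain a where a: "a \<in> A" "\<And>b. b \<in> A \<Longrightarrow> u \<bullet> b \<le> u \<bullet> a"
    using continuous_attains_sup[of A "\<lambda>a. u \<bullet> a"] assms by (auto simp: compacts_iff)
  have "support A u = u \<bullet> a"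
    unfolding support_def using a by (intro cSup_eq_maximum) auto
  with a that show ?thesis by metis
qed

lemma inner_le_support: "A \<in> compacts \<Longrightarrow> a \<in> A \<Longrightarrow> u \<bullet> a \<le> support A u"
  using support_attained by metis

lemma support_eqI:
  assumes "a \<in> A" "s = u \<bullet> a" "\<And>b. b \<in> A \<Longrightarrow> u \<bullet> b \<le> s"
  shows "support A u = s"
  unfolding support_def using assms by (intro cSup_eq_maximum) auto

lemma support_singleton [simp]: "support {a} u = u \<bullet> a"
  by (rule support_eqI) auto

lemma support_plus:
  assumes "A \<in> compacts" "B \<in> compacts"
  shows "support (A + B) u = support A u + support B u"
proof -
  obtain a where a: "a \<in> A" "support A u = u \<bullet> a" "\<And>b. b \<in> A \<Longrightarrow> u \<bullet> b \<le> support A u"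
    using support_attained[OF assms(1)] by metis
  obtain b where b: "b \<in> B" "support B u = u \<bullet> b" "\<And>c. c \<in> B \<Longrightarrow> u \<bullet> c \<le> support B u"
    using support_attained[OF assms(2)] by metis
  show ?thesis
  proof (rule support_eqI[of "a + b"])
    show "a + b \<in> A + B" using a b by auto
    show "support A u + support B u = u \<bullet> (a + b)" using a b by (simp add: inner_add_right)
    show "u \<bullet> c \<le> support A u + support B u" if "c \<in> A + B" for c
      using that a(3) b(3) by (auto elim!: set_plus_elim simp: inner_add_right intro!: add_mono)
  qed
qed

lemma support_sum:
  assumes "\<And>i. i \<in> I \<Longrightarrow> A i \<in> compacts"
  shows "support (\<Sum>i\<in>I. A i) u = (\<Sum>i\<in>I. support (A i) u)"
  using assms
  by (induction I rule: infinite_finite_induct)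
    (simp_all add: set_zero support_plus compacts_sum)

lemma support_scale:
  assumes "A \<in> compacts" "c \<ge> 0"
  shows "support (c \<bullet>\<^sub>S A) u = c * support A u"
proof -
  obtain a where a: "a \<in> A" "support A u = u \<bullet> a" "\<And>b. b \<in> A \<Longrightarrow> u \<bullet> b \<le> support A u"
    using support_attained[OF assms(1)] by metis
  show ?thesis
  proof (rule support_eqI[of "c *\<^sub>R a"])
    show "u \<bullet> b \<le> c * support A u" if "b \<in> c \<bullet>\<^sub>S A" for b
      using that a(3) assms(2) by (auto simp: set_scale_def mult_left_mono)
  qed (use a in \<open>auto simp: set_scale_def\<close>)
qed

lemma support_hull:
  assumes "A \<in> compacts"
  shows "support (convex hull A) u = support A u"
proof -
  obtain a where a: "a \<in> A" "support A u = u \<bullet> a" "\<And>b. b \<in> A \<Longrightarrow> u \<bullet> b \<le> support A u"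
    using support_attained[OF assms(1)] by metis
  have "convex hull A \<subseteq> {b. u \<bullet> b \<le> support A u}"
    using a(3) by (intro hull_minimal convex_halfspace_le) auto
  then show ?thesis
    using a by (intro support_eqI[of a]) (auto simp: hull_inc)
qed

lemma abs_support_diff_le:
  assumes A: "A \<in> compacts" and B: "B \<in> compacts" and u: "norm u = 1"
  shows "\<bar>support A u - support B u\<bar> \<le> hausdorff A B"
proof -
  have "support X u - support Y u \<le> hausdorff X Y"
    if XY: "X \<in> compacts" "Y \<in> compacts" for X Y :: "'a set"
  proof -
    obtain a where a: "a \<in> X" "support X u = u \<bullet> a"
      using support_attained[OF XY(1)] by metis
    obtain b where b: "b \<in> Y" "dist a b \<le> hausdorff X Y"
      using hausdorff_nearest XY a(1) by blast
    have "u \<bullet> a - u \<bullet> b \<le> dist a b"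
      using norm_cauchy_schwarz[of u "a - b"] u by (simp add: dist_norm inner_diff_right)
    then show ?thesis
      using a b inner_le_support[OF XY(2) b(1), of u] by linarith
  qed
  from this[OF A B] this[OF B A] show ?thesis
    by (simp add: hausdorff_commute)
qed

lemma abs_support_le:
  assumes "A \<in> compacts" "A \<subseteq> cball 0 R" "norm u = 1"
  shows "\<bar>support A u\<bar> \<le> R"
proof -
  obtain a where a: "a \<in> A" "support A u = u \<bullet> a"
    using support_attained[OF assms(1)] by metis
  have "\<bar>u \<bullet> a\<bar> \<le> norm a"
    using Cauchy_Schwarz_ineq2[of u a] assms(3) by simp
  with a assms(2) show ?thesis by auto
qed

text \<open>
  A point \<open>y\<close> outside \<open>B\<close> is separated from \<open>B\<close> by the hyperplane through the point of \<open>B\<close>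
  nearest to \<open>y\<close>, so its distance to \<open>B\<close> is read off from the support function.
\<close>

lemma infdist_le_if_support:
  assumes B: "B \<in> convex_compacts" and c: "c \<ge> 0"
    and *: "\<And>u. norm u = 1 \<Longrightarrow> u \<bullet> y \<le> support B u + c"
  shows "infdist y B \<le> c"
proof -
  have B': "B \<in> compacts" "convex B" "closed B" "B \<noteq> {}"
    using B by (auto simp: convex_compacts_def compacts_iff compact_imp_closed)
  obtain b where b: "b \<in> B" "infdist y B = dist y b"
    using infdist_attains_inf B' by metis
  have near: "\<forall>z\<in>B. dist y b \<le> dist y z"
    using b infdist_le by metis
  show ?thesis
  proof (cases "y = b")
    case True
    with b c show ?thesis by simp
  next
    case False
    define u where "u = (y - b) /\<^sub>R norm (y - b)"
    have u: "norm u = 1"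
      using False by (simp add: u_def)
    have "support B u = u \<bullet> b"
    proof (rule support_eqI)
      fix z assume "z \<in> B"
      then have "(y - b) \<bullet> (z - b) \<le> 0"
        using any_closest_point_dot[of B b z y] B' b near by auto
      then have "u \<bullet> (z - b) \<le> 0"
        unfolding u_def by (simp add: mult_nonneg_nonpos)
      then show "u \<bullet> z \<le> u \<bullet> b"
        by (simp add: inner_diff_right)
    qed (use b in auto)
    with *[OF u] have "u \<bullet> (y - b) \<le> c"
      by (simp add: inner_diff_right)
    moreover have "u \<bullet> (y - b) = norm (y - b)"
      using False by (simp add: u_def dot_square_norm power2_eq_square)
    ultimately show ?thesis
      using b by (simp add: dist_norm)
  qed
qed

lemma hausdorff_le_if_support:
  assumes A: "A \<in> convex_compacts" and B: "B \<in> convex_compacts" and c: "c \<ge> 0"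
    and *: "\<And>u. norm u = 1 \<Longrightarrow> \<bar>support A u - support B u\<bar> \<le> c"
  shows "hausdorff A B \<le> c"
proof (rule hausdorff_leI)
  show "infdist a B \<le> c" if "a \<in> A" for a
  proof (rule infdist_le_if_support[OF B c])
    show "u \<bullet> a \<le> support B u + c" if "norm u = 1" for u
      using inner_le_support[OF convex_compactsD(1)[OF A] \<open>a \<in> A\<close>, of u] *[OF that] by linarith
  qed
  show "infdist b A \<le> c" if "b \<in> B" for b
  proof (rule infdist_le_if_support[OF A c])
    show "u \<bullet> b \<le> support A u + c" if "norm u = 1" for u
      using inner_le_support[OF convex_compactsD(1)[OF B] \<open>b \<in> B\<close>, of u] *[OF that] by linarith
  qed
qed (use A B in \<open>auto dest: convex_compactsD\<close>)

text \<open>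
  On the unit sphere, a uniform limit of support functions is the support function of the
  intersection of the half-spaces that it prescribes.  This plays the role of completeness of the
  Hausdorff metric: a nearby approximant \<open>S\<close> is followed through ever better ones by compactness,
  and the limit point satisfies all the prescribed inequalities.
\<close>

lemma uniform_limit_of_supports:
  fixes H :: "'a::euclidean_space \<Rightarrow> real"
  assumes approx: "\<And>\<epsilon>. \<epsilon> > 0 \<Longrightarrow>
      \<exists>S\<in>convex_compacts. \<forall>u. norm u = 1 \<longrightarrow> \<bar>support S u - H u\<bar> \<le> \<epsilon>"
  defines "I \<equiv> {y. \<forall>u. norm u = 1 \<longrightarrow> u \<bullet> y \<le> H u}"
  shows "I \<in> convex_compacts" and "\<And>u. norm u = 1 \<Longrightarrow> support I u = H u"
proof -
  have near: "\<exists>z\<in>I. dist y z \<le> \<epsilon>"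
    if S: "S \<in> convex_compacts" and SH: "\<And>u. norm u = 1 \<Longrightarrow> \<bar>support S u - H u\<bar> \<le> \<epsilon>"
      and y: "y \<in> S" and \<epsilon>: "\<epsilon> > 0" for S y \<epsilon>
  proof -
    have "\<exists>T. T \<in> convex_compacts \<and>
        (\<forall>u. norm u = 1 \<longrightarrow> \<bar>support T u - H u\<bar> \<le> 1 / real (Suc k))" for k
      using approx[of "1 / real (Suc k)"] by auto
    then obtain T where T: "\<And>k. T k \<in> convex_compacts"
      and TH: "\<And>k u. norm u = 1 \<Longrightarrow> \<bar>support (T k) u - H u\<bar> \<le> 1 / real (Suc k)"
      by metis
    have "\<exists>z. z \<in> T k \<and> dist y z \<le> \<epsilon> + 1 / real (Suc k)" for k
    proof -
      have "infdist y (T k) \<le> \<epsilon> + 1 / real (Suc k)"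
      proof (rule infdist_le_if_support[OF T])
        show "u \<bullet> y \<le> support (T k) u + (\<epsilon> + 1 / real (Suc k))" if u: "norm u = 1" for u
          using inner_le_support[OF convex_compactsD(1)[OF S] y, of u] SH[OF u] TH[OF u, of k]
          by linarith
      qed (use \<epsilon> in auto)
      moreover obtain z where "z \<in> T k" "infdist y (T k) = dist y z"
        using infdist_attains_inf[of "T k" y] T[of k]
        by (auto simp: convex_compacts_def compacts_iff compact_imp_closed)
      ultimately show ?thesis by metis
    qed
    then obtain z where zT: "\<And>k. z k \<in> T k"
      and zd: "\<And>k. dist y (z k) \<le> \<epsilon> + 1 / real (Suc k)"
      by metis
    have "z k \<in> cball y (\<epsilon> + 1)" for k
      using zd[of k] by (auto intro: order_trans simp: divide_le_eq)
    then obtain l r where r: "strict_mono r" and l: "(z \<circ> r) \<longlonglongrightarrow> l"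
      using compact_cball[of y "\<epsilon> + 1"] unfolding compact_def by metis
    have lim0: "(\<lambda>k. c + 1 / real (Suc (r k))) \<longlonglongrightarrow> c" for c :: real
    proof -
      have "((\<lambda>k. 1 / real (Suc k)) \<circ> r) \<longlonglongrightarrow> 0"
        using LIMSEQ_subseq_LIMSEQ[OF lim_1_over_n[THEN LIMSEQ_Suc] r] by (simp add: o_def)
      then show ?thesis
        using tendsto_add[OF tendsto_const] by (fastforce simp: o_def)
    qed
    have l': "(\<lambda>k. z (r k)) \<longlonglongrightarrow> l"
      using l by (simp add: o_def)
    have "dist y l \<le> \<epsilon>"
      by (rule LIMSEQ_le[OF tendsto_dist[OF tendsto_const l'] lim0]) (use zd in auto)
    moreover have "u \<bullet> l \<le> H u" if u: "norm u = 1" for u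
    proof (rule LIMSEQ_le[OF tendsto_inner[OF tendsto_const l'] lim0])
      have "u \<bullet> z (r k) \<le> H u + 1 / real (Suc (r k))" for k
        using inner_le_support[OF convex_compactsD(1)[OF T] zT, of u "r k"] TH[OF u, of "r k"]
        by linarith
      then show "\<exists>N. \<forall>k\<ge>N. u \<bullet> z (r k) \<le> H u + 1 / real (Suc (r k))"
        by blast
    qed
    ultimately show ?thesis
      by (auto simp: I_def)
  qed
  obtain S where S: "S \<in> convex_compacts"
    and SH: "\<And>u. norm u = 1 \<Longrightarrow> \<bar>support S u - H u\<bar> \<le> 1"
    using approx[of 1] by auto
  have I_eq: "I = (\<Inter>u\<in>{u. norm u = 1}. {y. u \<bullet> y \<le> H u})"
    by (auto simp: I_def)
  have "closed I" "convex I"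
    unfolding I_eq by (auto intro!: closed_INT convex_INT closed_halfspace_le convex_halfspace_le)
  moreover have "I \<noteq> {}"
    using near[OF S SH] S by (fastforce simp: convex_compacts_def compacts_iff)
  moreover have "bounded I"
  proof -
    have "bounded S"
      using S by (auto simp: convex_compacts_def compacts_iff compact_imp_bounded)
    then obtain R where R: "S \<subseteq> cball 0 R"
      by (metis bounded_iff mem_cball_0 subsetI)
    have "norm y \<le> \<bar>R\<bar> + 1" if y: "y \<in> I" for y
    proof (cases "y = 0")
      case False
      define u where "u = y /\<^sub>R norm y"
      have u: "norm u = 1" using False by (simp add: u_def)
      have "norm y = u \<bullet> y"
        using False by (simp add: u_def dot_square_norm power2_eq_square)
      also have "\<dots> \<le> H u"
        using y u by (auto simp: I_def)
      finally show ?thesis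
        using SH[OF u] abs_support_le[OF convex_compactsD(1)[OF S] R u] by linarith
    qed auto
    then show ?thesis
      by (auto simp: bounded_iff)
  qed
  ultimately show I: "I \<in> convex_compacts"
    by (auto simp: convex_compacts_def compacts_iff compact_eq_bounded_closed)
  show "support I u = H u" if u: "norm u = 1" for u
  proof (rule antisym)
    show "support I u \<le> H u"
      using support_attained[OF convex_compactsD(1)[OF I], of u] u by (fastforce simp: I_def)
    show "H u \<le> support I u"
    proof (rule field_le_epsilon)
      fix e :: real assume "e > 0"
      then obtain S where S: "S \<in> convex_compacts"
        and SH: "\<And>u. norm u = 1 \<Longrightarrow> \<bar>support S u - H u\<bar> \<le> e / 2"
        using approx[of "e / 2"] by auto
      obtain y where y: "y \<in> S" "support S u = u \<bullet> y"
        using support_attained[OF convex_compactsD(1)[OF S]] by metis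
      obtain z where z: "z \<in> I" "dist y z \<le> e / 2"
        using near[OF S SH y(1)] \<open>e > 0\<close> by auto
      have "u \<bullet> y - u \<bullet> z \<le> e / 2"
        using norm_cauchy_schwarz[of u "y - z"] u z(2) by (simp add: dist_norm inner_diff_right)
      then show "H u \<le> support I u + e"
        using SH[OF u] y(2) inner_le_support[OF convex_compactsD(1)[OF I] z(1), of u] by linarith
    qed
  qed
qed

section \<open>Minkowski sums are nearly convex\<close>

text \<open>
  A Pythagorean form of the Shapley--Folkman theorem.  Moving the summands of a point of
  \<open>\<Sum> co A\<^sub>i\<close> into the sets \<open>A\<^sub>i\<close> one after another, the next displacement can always be chosen
  at a non-acute angle to the error accumulated so far, since the value of a linear functional at a
  point of \<open>co A\<^sub>i\<close> does not exceed its maximum over \<open>A\<^sub>i\<close>.  So the squared error grows by at most the squared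
  diameter.
\<close>

lemma Shapley_Folkman_Pythagoras:
  fixes A :: "'i \<Rightarrow> 'a::euclidean_space set"
  assumes "finite I" and "\<And>i. i \<in> I \<Longrightarrow> A i \<in> compacts"
    and "\<And>i a b. i \<in> I \<Longrightarrow> a \<in> A i \<Longrightarrow> b \<in> A i \<Longrightarrow> dist a b \<le> D i"
    and "y \<in> (\<Sum>i\<in>I. convex hull (A i))"
  shows "\<exists>b \<in> (\<Sum>i\<in>I. A i). (norm (y - b))\<^sup>2 \<le> (\<Sum>i\<in>I. (D i)\<^sup>2)"
  using assms
proof (induction I arbitrary: y rule: finite_induct)
  case empty
  then show ?case by (auto simp: set_zero)
next
  case (insert i I)
  then obtain a y' where y: "y = a + y'" "a \<in> convex hull (A i)"
    "y' \<in> (\<Sum>i\<in>I. convex hull (A i))"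
    by (auto elim!: set_plus_elim)
  obtain b' where b': "b' \<in> (\<Sum>i\<in>I. A i)" "(norm (y' - b'))\<^sup>2 \<le> (\<Sum>i\<in>I. (D i)\<^sup>2)"
    using insert.IH[OF _ _ y(3)] insert.prems by auto
  define v where "v = y' - b'"
  have Ai: "A i \<in> compacts" using insert.prems by auto
  obtain b where b: "b \<in> A i" "support (A i) v = v \<bullet> b"
    using support_attained[OF Ai] by metis
  have hull: "convex hull (A i) \<in> compacts"
    using convex_compactsD(1)[OF convex_compacts_hull[OF Ai]] .
  \<comment> \<open>the choice of \<open>b\<close> as a maximizer makes the cross term in the squared error nonpositive\<close>
  have "v \<bullet> a \<le> v \<bullet> b"
    using inner_le_support[OF hull y(2), of v] b(2) by (simp add: support_hull[OF Ai])
  moreover have "norm (a - b) \<le> D i"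
  proof -
    have "convex hull (A i) \<subseteq> cball b (D i)"
      using insert.prems(2)[of i b] b(1) by (intro hull_minimal) auto
    with y(2) show ?thesis by (auto simp: dist_norm norm_minus_commute)
  qed
  then have "(norm (a - b))\<^sup>2 \<le> (D i)\<^sup>2"
    by (intro power_mono) auto
  moreover have "(norm (v + (a - b)))\<^sup>2 = (norm v)\<^sup>2 + 2 * (v \<bullet> a - v \<bullet> b) + (norm (a - b))\<^sup>2"
    by (simp only: power2_norm_eq_inner) (simp add: algebra_simps inner_commute)
  ultimately have "(norm (v + (a - b)))\<^sup>2 \<le> (\<Sum>i\<in>insert i I. (D i)\<^sup>2)"
    using b'(2) insert.hyps by (simp add: v_def)
  moreover have "y - (b + b') = v + (a - b)"
    by (simp add: y v_def)
  ultimately show ?case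
    using b(1) b'(1) insert.hyps by (metis set_plus_intro sum.insert)
qed

section \<open>The Riemann--Minkowski integral\<close>

lemma tagged_partition_mono:
  assumes "tagged_partition N t \<xi>" "i \<le> j" "j \<le> N"
  shows "t i \<le> t j"
  using assms(2,3)
proof (induction j rule: dec_induct)
  case (step j)
  then have "t j < t (Suc j)" using assms(1) by (auto simp: tagged_partition_def)
  with step show ?case by simp
qed simp

lemma tagged_partition_tag:
  assumes "tagged_partition N t \<xi>" "i < N"
  shows "\<xi> i \<in> {t i..t (Suc i)}" "{t i..t (Suc i)} \<subseteq> {0..1}" "\<xi> i \<in> {0..1}"
    and "0 < t (Suc i) - t i" "t (Suc i) - t i \<le> mesh N t"
proof -
  show 1: "\<xi> i \<in> {t i..t (Suc i)}" "0 < t (Suc i) - t i"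
    using assms by (auto simp: tagged_partition_def)
  have "0 \<le> t i" "t (Suc i) \<le> 1"
    using tagged_partition_mono[OF assms(1), of 0 i] tagged_partition_mono[OF assms(1), of "Suc i" N]
      assms by (auto simp: tagged_partition_def)
  then show 2: "{t i..t (Suc i)} \<subseteq> {0..1}" by auto
  with 1 show "\<xi> i \<in> {0..1}" by auto
  show "t (Suc i) - t i \<le> mesh N t"
    unfolding mesh_def using assms(2) by (intro Max_ge) auto
qed

lemma tagged_partition_lengths:
  assumes "tagged_partition N t \<xi>"
  shows "(\<Sum>i<N. t (Suc i) - t i) = 1"
  using assms by (simp add: sum_lessThan_telescope tagged_partition_def)

lemma regular_partition:
  assumes "N > 0"
  shows "tagged_partition N (\<lambda>i. real i / real N) (\<lambda>i. real i / real N)"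
    and "mesh N (\<lambda>i. real i / real N) = 1 / real N"
proof -
  show "tagged_partition N (\<lambda>i. real i / real N) (\<lambda>i. real i / real N)"
    using assms by (auto simp: tagged_partition_def divide_right_mono divide_strict_right_mono)
  have *: "real (Suc i) / real N - real i / real N = 1 / real N" for i
    by (simp add: add_divide_distrib)
  show "mesh N (\<lambda>i. real i / real N) = 1 / real N"
    using assms unfolding mesh_def * by (subst image_constant_conv) auto
qed

lemma exists_fine_partition:
  assumes "\<eta> > 0"
  shows "\<exists>N t \<xi>. tagged_partition N t \<xi> \<and> mesh N t < \<eta>"
proof -
  obtain k where "inverse (real (Suc k)) < \<eta>"
    using reals_Archimedean[OF assms] by blast
  with regular_partition[of "Suc k"] show ?thesis
    by (intro exI[of _ "Suc k"] exI conjI) (auto simp: inverse_eq_divide)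
qed

lemma RM_sum_compacts:
  assumes "\<And>s. s \<in> {0..1} \<Longrightarrow> g s \<in> compacts" "tagged_partition N t \<xi>"
  shows "RM_sum g N t \<xi> \<in> compacts"
  unfolding RM_sum_def using assms tagged_partition_tag(3)
  by (intro compacts_sum compacts_scale) blast

lemma has_RM_integralE:
  assumes "has_RM_integral g I" "\<epsilon> > 0"
  obtains \<eta> where "\<eta> > 0"
    "\<And>N t \<xi>. tagged_partition N t \<xi> \<Longrightarrow> mesh N t < \<eta> \<Longrightarrow> hausdorff (RM_sum g N t \<xi>) I < \<epsilon>"
proof -
  have "\<exists>\<eta>>0. \<forall>N t \<xi>. tagged_partition N t \<xi> \<and> mesh N t < \<eta> \<longrightarrow> hausdorff (RM_sum g N t \<xi>) I < \<epsilon>"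
    using assms by (simp add: has_RM_integral_def)
  then show ?thesis using that by auto
qed

lemma RM_integral_eqI:
  fixes g :: "real \<Rightarrow> 'a::euclidean_space set"
  assumes g: "\<And>s. s \<in> {0..1} \<Longrightarrow> g s \<in> compacts" and I: "has_RM_integral g I"
  shows "RM_integral g = I"
  unfolding RM_integral_def
proof (rule the_equality)
  show "has_RM_integral g I" by fact
  fix J assume J: "has_RM_integral g J"
  have c: "I \<in> compacts" "J \<in> compacts"
    using I J by (auto simp: has_RM_integral_def)
  have "hausdorff J I \<le> 0"
  proof (rule field_le_epsilon)
    fix e :: real assume "e > 0"
    then have e: "e / 2 > 0" by simp
    obtain \<eta>1 where \<eta>1: "\<eta>1 > 0"
      "\<And>N t \<xi>. tagged_partition N t \<xi> \<Longrightarrow> mesh N t < \<eta>1 \<Longrightarrow> hausdorff (RM_sum g N t \<xi>) I < e / 2"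
      using has_RM_integralE[OF I e] by metis
    obtain \<eta>2 where \<eta>2: "\<eta>2 > 0"
      "\<And>N t \<xi>. tagged_partition N t \<xi> \<Longrightarrow> mesh N t < \<eta>2 \<Longrightarrow> hausdorff (RM_sum g N t \<xi>) J < e / 2"
      using has_RM_integralE[OF J e] by metis
    obtain N t \<xi> where p: "tagged_partition N t \<xi>" "mesh N t < min \<eta>1 \<eta>2"
      using exists_fine_partition[of "min \<eta>1 \<eta>2"] \<eta>1 \<eta>2 by auto
    have "hausdorff J I \<le> hausdorff J (RM_sum g N t \<xi>) + hausdorff (RM_sum g N t \<xi>) I"
      by (intro hausdorff_triangle c RM_sum_compacts[OF g p(1)])
    also have "\<dots> \<le> 0 + e"
      using \<eta>1(2)[OF p(1)] \<eta>2(2)[OF p(1)] p(2) by (simp add: hausdorff_commute)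
    finally show "hausdorff J I \<le> 0 + e" .
  qed
  then show "J = I"
    using hausdorff_le_0D c by blast
qed

text \<open>
  The \<open>i\<close>-th summand has diameter at most \<open>2 R d\<^sub>i\<close>, where \<open>d\<^sub>i\<close> is the length of the \<open>i\<close>-th interval,
  and \<open>\<Sum> d\<^sub>i\<^sup>2 \<le> mesh \<cdot> \<Sum> d\<^sub>i = mesh\<close>.
\<close>

lemma RM_sum_near_hull:
  fixes g :: "real \<Rightarrow> 'a::euclidean_space set"
  assumes g: "\<And>s. s \<in> {0..1} \<Longrightarrow> g s \<in> compacts"
    and R: "\<And>s. s \<in> {0..1} \<Longrightarrow> g s \<subseteq> cball 0 R"
    and p: "tagged_partition N t \<xi>"
  shows "hausdorff (RM_sum g N t \<xi>) (convex hull (RM_sum g N t \<xi>)) \<le> 2 * R * sqrt (mesh N t)"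
proof (rule hausdorff_leI)
  let ?S = "RM_sum g N t \<xi>"
  let ?d = "\<lambda>i. t (Suc i) - t i"
  show S: "?S \<in> compacts" using RM_sum_compacts[OF g p] .
  show "convex hull ?S \<in> compacts"
    using convex_compactsD(1)[OF convex_compacts_hull[OF S]] .
  obtain a where "a \<in> g 0" using g[of 0] by (auto simp: compacts_iff)
  with R[of 0] have R0: "R \<ge> 0"
    using norm_ge_zero[of a] by (auto simp del: norm_ge_zero)
  have "N > 0"
    using p by (auto simp: tagged_partition_def intro: gr0I)
  then have m0: "mesh N t \<ge> 0"
    using tagged_partition_tag(4,5)[OF p, of 0] by linarith
  show "infdist a (convex hull ?S) \<le> 2 * R * sqrt (mesh N t)" if "a \<in> ?S" for a
    using that R0 m0 by (simp add: hull_inc)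
  show "infdist y ?S \<le> 2 * R * sqrt (mesh N t)" if y: "y \<in> convex hull ?S" for y
  proof -
    have "\<exists>b \<in> (\<Sum>i<N. ?d i \<bullet>\<^sub>S g (\<xi> i)). (norm (y - b))\<^sup>2 \<le> (\<Sum>i<N. (?d i * (2 * R))\<^sup>2)"
    proof (rule Shapley_Folkman_Pythagoras)
      show "?d i \<bullet>\<^sub>S g (\<xi> i) \<in> compacts" if "i \<in> {..<N}" for i
        using that g tagged_partition_tag(3)[OF p] by (auto intro!: compacts_scale)
      show "dist a b \<le> ?d i * (2 * R)"
        if i: "i \<in> {..<N}" and mem: "a \<in> ?d i \<bullet>\<^sub>S g (\<xi> i)" "b \<in> ?d i \<bullet>\<^sub>S g (\<xi> i)"
        for i a b
      proof -
        obtain a' b' where ab: "a = ?d i *\<^sub>R a'" "b = ?d i *\<^sub>R b'" "a' \<in> g (\<xi> i)" "b' \<in> g (\<xi> i)"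
          using mem by (auto simp: set_scale_def)
        have "norm a' \<le> R" "norm b' \<le> R"
          using R[OF tagged_partition_tag(3)[OF p], of i] i ab(3,4) by (auto simp: subset_iff)
        then have "dist a' b' \<le> 2 * R"
          using norm_triangle_ineq4[of a' b'] by (simp add: dist_norm)
        moreover have "dist a b = ?d i * dist a' b'"
          using tagged_partition_tag(4)[OF p, of i] i ab by (simp add: dist_norm flip: scaleR_right_diff_distrib)
        ultimately show ?thesis
          using tagged_partition_tag(4)[OF p, of i] i by simp
      qed
      show "y \<in> (\<Sum>i<N. convex hull (?d i \<bullet>\<^sub>S g (\<xi> i)))"
        using y by (simp add: RM_sum_def convex_hull_set_sum)
    qed simp
    then obtain b where b: "b \<in> ?S" "(norm (y - b))\<^sup>2 \<le> (\<Sum>i<N. (?d i * (2 * R))\<^sup>2)"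
      by (auto simp: RM_sum_def)
    have "(\<Sum>i<N. (?d i * (2 * R))\<^sup>2) \<le> (\<Sum>i<N. ?d i * (mesh N t * (2 * R)\<^sup>2))"
    proof (rule sum_mono)
      fix i assume "i \<in> {..<N}"
      then have "0 < ?d i" "?d i \<le> mesh N t" using tagged_partition_tag(4,5)[OF p] by auto
      then have "?d i * (?d i * (2 * R)\<^sup>2) \<le> ?d i * (mesh N t * (2 * R)\<^sup>2)"
        by (intro mult_right_mono mult_left_mono) auto
      then show "(?d i * (2 * R))\<^sup>2 \<le> ?d i * (mesh N t * (2 * R)\<^sup>2)"
        by (simp only: power2_eq_square mult_ac)
    qed
    also have "\<dots> = mesh N t * (2 * R)\<^sup>2"
      using tagged_partition_lengths[OF p] by (simp flip: sum_distrib_right)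
    also have "\<dots> = (2 * R * sqrt (mesh N t))\<^sup>2"
      using m0 by (simp add: power_mult_distrib)
    finally have "(norm (y - b))\<^sup>2 \<le> (2 * R * sqrt (mesh N t))\<^sup>2"
      using b(2) by (rule order_trans[rotated])
    then have "norm (y - b) \<le> 2 * R * sqrt (mesh N t)"
      by (rule power2_le_imp_le) (use R0 m0 in simp)
    then show ?thesis
      using infdist_le[OF b(1), of y] by (simp add: dist_norm)
  qed
qed

lemma Riemann_sum_error:
  fixes \<phi> :: "real \<Rightarrow> real"
  assumes cont: "continuous_on {0..1} \<phi>" and p: "tagged_partition N t \<xi>"
    and osc: "\<And>s s'. s \<in> {0..1} \<Longrightarrow> s' \<in> {0..1} \<Longrightarrow> \<bar>s - s'\<bar> \<le> mesh N t \<Longrightarrow> \<bar>\<phi> s - \<phi> s'\<bar> \<le> \<epsilon>"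
  shows "\<bar>(\<Sum>i<N. (t (Suc i) - t i) * \<phi> (\<xi> i)) - integral {0..1} \<phi>\<bar> \<le> \<epsilon>"
proof -
  have "\<bar>(\<Sum>i<k. (t (Suc i) - t i) * \<phi> (\<xi> i)) - integral {t 0..t k} \<phi>\<bar> \<le> \<epsilon> * (t k - t 0)"
    if "k \<le> N" for k
    using that
  proof (induction k)
    case (Suc k)
    let ?d = "t (Suc k) - t k"
    have k: "k < N" using Suc by simp
    note tag = tagged_partition_tag[OF p k]
    have le: "t 0 \<le> t k" "t k \<le> t (Suc k)" "t 0 = 0"
      using tagged_partition_mono[OF p, of 0 k] k tag(4) p by (auto simp: tagged_partition_def)
    have "\<phi> integrable_on {t 0..t (Suc k)}"
      using le tag(2) by (intro integrable_continuous_real continuous_on_subset[OF cont]) auto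
    then have split: "integral {t 0..t (Suc k)} \<phi> = integral {t 0..t k} \<phi> + integral {t k..t (Suc k)} \<phi>"
      using Henstock_Kurzweil_Integration.integral_combine[of "t 0" "t k" "t (Suc k)" \<phi>] le by simp
    have int: "\<phi> integrable_on {t k..t (Suc k)}"
      using tag(2) by (intro integrable_continuous_real continuous_on_subset[OF cont]) auto
    have "((\<lambda>s. \<phi> (\<xi> k) - \<phi> s) has_integral (?d * \<phi> (\<xi> k) - integral {t k..t (Suc k)} \<phi>))
        {t k..t (Suc k)}"
      using has_integral_diff[OF has_integral_const_real[of "\<phi> (\<xi> k)"] integrable_integral[OF int]]
        le by simp
    moreover have "\<bar>\<phi> (\<xi> k) - \<phi> s\<bar> \<le> \<epsilon>" if "s \<in> {t k..t (Suc k)}" for s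
      using that tag by (intro osc) auto
    moreover have "\<epsilon> \<ge> 0"
      using osc[of 0 0] tag(4,5) by auto
    ultimately have "\<bar>?d * \<phi> (\<xi> k) - integral {t k..t (Suc k)} \<phi>\<bar> \<le> \<epsilon> * ?d"
      using has_integral_bound_real[of \<epsilon> "{}" "\<lambda>s. \<phi> (\<xi> k) - \<phi> s" _ "t k" "t (Suc k)"] le by simp
    with Suc k split show ?case
      by (simp add: algebra_simps)
  qed simp
  from this[of N] p show ?thesis
    by (simp add: tagged_partition_def)
qed

text \<open>
  The Riemann--Minkowski sums of a bounded function with equicontinuous support functions have
  asymptotically the same support functions as the integral, and they are asymptotically convex;
  so they converge to a convex set even if the values of the function are not convex.
\<close>

lemma RM_integral_support:
  fixes g :: "real \<Rightarrow> 'a::euclidean_space set"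
  assumes g: "\<And>s. s \<in> {0..1} \<Longrightarrow> g s \<in> compacts"
    and R: "\<And>s. s \<in> {0..1} \<Longrightarrow> g s \<subseteq> cball 0 R"
    and equicont: "\<And>\<epsilon>. \<epsilon> > 0 \<Longrightarrow> \<exists>\<eta>>0. \<forall>s\<in>{0..1}. \<forall>s'\<in>{0..1}. \<bar>s - s'\<bar> < \<eta> \<longrightarrow>
      (\<forall>u. norm u = 1 \<longrightarrow> \<bar>support (g s) u - support (g s') u\<bar> \<le> \<epsilon>)"
  shows "RM_integral g \<in> convex_compacts"
    and "\<And>u. norm u = 1 \<Longrightarrow> support (RM_integral g) u = integral {0..1} (\<lambda>s. support (g s) u)"
proof -
  define H where "H u = integral {0..1} (\<lambda>s. support (g s) u)" for u
  define I where "I = {y. \<forall>u. norm u = 1 \<longrightarrow> u \<bullet> y \<le> H u}"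
  have cont: "continuous_on {0..1} (\<lambda>s. support (g s) u)" if u: "norm u = 1" for u
    unfolding continuous_on_iff
  proof (intro ballI allI impI)
    fix s e :: real assume s: "s \<in> {0..1}" and "e > 0"
    then obtain \<eta> where "\<eta> > 0" "\<forall>s\<in>{0..1}. \<forall>s'\<in>{0..1}. \<bar>s - s'\<bar> < \<eta> \<longrightarrow>
      (\<forall>u. norm u = 1 \<longrightarrow> \<bar>support (g s) u - support (g s') u\<bar> \<le> e / 2)"
      using equicont[of "e / 2"] by auto
    with s u \<open>e > 0\<close> show "\<exists>d>0. \<forall>s'\<in>{0..1}. dist s' s < d \<longrightarrow>
        dist (support (g s') u) (support (g s) u) < e"
      by (intro exI[of _ \<eta>]) (fastforce simp: dist_real_def)
  qed
  have sums: "\<exists>\<eta>>0. \<forall>N t \<xi>. tagged_partition N t \<xi> \<longrightarrow> mesh N t < \<eta> \<longrightarrow>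
      (\<forall>u. norm u = 1 \<longrightarrow> \<bar>support (convex hull (RM_sum g N t \<xi>)) u - H u\<bar> \<le> \<epsilon>)"
    if \<epsilon>: "\<epsilon> > 0" for \<epsilon>
  proof -
    obtain \<eta> where \<eta>: "\<eta> > 0" "\<And>s s' u. s \<in> {0..1} \<Longrightarrow> s' \<in> {0..1} \<Longrightarrow> \<bar>s - s'\<bar> < \<eta> \<Longrightarrow>
      norm u = 1 \<Longrightarrow> \<bar>support (g s) u - support (g s') u\<bar> \<le> \<epsilon>"
      using equicont[OF \<epsilon>] by auto
    have "\<bar>support (convex hull (RM_sum g N t \<xi>)) u - H u\<bar> \<le> \<epsilon>"
      if p: "tagged_partition N t \<xi>" and m: "mesh N t < \<eta>" and u: "norm u = 1" for N t \<xi> u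
    proof -
      have c: "g (\<xi> i) \<in> compacts" if "i < N" for i
        using g tagged_partition_tag(3)[OF p that] by auto
      have "support (convex hull (RM_sum g N t \<xi>)) u = support (RM_sum g N t \<xi>) u"
        by (rule support_hull[OF RM_sum_compacts[OF g p]])
      also have "\<dots> = (\<Sum>i<N. support ((t (Suc i) - t i) \<bullet>\<^sub>S g (\<xi> i)) u)"
        unfolding RM_sum_def using c by (intro support_sum compacts_scale) auto
      also have "\<dots> = (\<Sum>i<N. (t (Suc i) - t i) * support (g (\<xi> i)) u)"
        using c tagged_partition_tag(4)[OF p]
        by (intro sum.cong refl support_scale) (auto simp: less_imp_le)
      finally show ?thesis
        unfolding H_def using Riemann_sum_error[OF cont[OF u] p, of \<epsilon>] \<eta>(2) u m by auto
    qed
    with \<eta>(1) show ?thesis by blast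
  qed
  have approx: "\<exists>S\<in>convex_compacts. \<forall>u. norm u = 1 \<longrightarrow> \<bar>support S u - H u\<bar> \<le> \<epsilon>"
    if "\<epsilon> > 0" for \<epsilon>
  proof -
    obtain \<eta> where "\<eta> > 0" and \<eta>: "\<And>N t \<xi> u. tagged_partition N t \<xi> \<Longrightarrow> mesh N t < \<eta> \<Longrightarrow>
        norm u = 1 \<Longrightarrow> \<bar>support (convex hull (RM_sum g N t \<xi>)) u - H u\<bar> \<le> \<epsilon>"
      using sums[OF \<open>\<epsilon> > 0\<close>] by blast
    obtain N t \<xi> where p: "tagged_partition N t \<xi>" "mesh N t < \<eta>"
      using exists_fine_partition[OF \<open>\<eta> > 0\<close>] by blast
    show ?thesis
    proof (intro bexI allI impI)
      show "\<bar>support (convex hull (RM_sum g N t \<xi>)) u - H u\<bar> \<le> \<epsilon>" if "norm u = 1" for u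
        by (rule \<eta>[OF p that])
      show "convex hull (RM_sum g N t \<xi>) \<in> convex_compacts"
        by (intro convex_compacts_hull RM_sum_compacts[OF g p(1)])
    qed
  qed
  note I = uniform_limit_of_supports[OF approx, folded I_def]
  have "has_RM_integral g I"
    unfolding has_RM_integral_def
  proof (intro conjI allI impI)
    show "I \<in> compacts" using I convex_compactsD by blast
    fix \<epsilon> :: real assume \<epsilon>: "\<epsilon> > 0"
    obtain a where "a \<in> g 0" using g[of 0] by (auto simp: compacts_iff)
    with R[of 0] have R0: "R \<ge> 0"
      using norm_ge_zero[of a] by (auto simp del: norm_ge_zero)
    obtain \<eta> where \<eta>: "\<eta> > 0" "\<And>N t \<xi> u. tagged_partition N t \<xi> \<Longrightarrow> mesh N t < \<eta> \<Longrightarrow>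
        norm u = 1 \<Longrightarrow> \<bar>support (convex hull (RM_sum g N t \<xi>)) u - H u\<bar> \<le> \<epsilon> / 2"
      using sums[of "\<epsilon> / 2"] \<epsilon> by auto
    \<comment> \<open>\<open>R + 1\<close> rather than \<open>R\<close>, as \<open>R\<close> may be zero\<close>
    define \<rho> where "\<rho> = (\<epsilon> / (4 * (R + 1)))\<^sup>2"
    have \<rho>: "\<rho> > 0" using \<epsilon> R0 by (simp add: \<rho>_def)
    have "hausdorff (RM_sum g N t \<xi>) I < \<epsilon>"
      if p: "tagged_partition N t \<xi>" and m: "mesh N t < min \<eta> \<rho>" for N t \<xi>
    proof -
      let ?S = "RM_sum g N t \<xi>"
      have S: "?S \<in> compacts" by (rule RM_sum_compacts[OF g p])
      note hull = convex_compacts_hull[OF S]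
      have "sqrt (mesh N t) < \<epsilon> / (4 * (R + 1))"
        using m \<epsilon> R0 by (intro real_less_lsqrt) (auto simp: \<rho>_def)
      then have "2 * (R + 1) * sqrt (mesh N t) < \<epsilon> / 2"
        using R0 by (simp add: field_simps)
      moreover have "mesh N t \<ge> 0"
        using p tagged_partition_tag(4,5)[OF p, of 0]
        by (cases "N = 0") (auto simp: tagged_partition_def)
      then have "2 * R * sqrt (mesh N t) \<le> 2 * (R + 1) * sqrt (mesh N t)"
        by (intro mult_right_mono) auto
      moreover have "hausdorff ?S (convex hull ?S) \<le> 2 * R * sqrt (mesh N t)"
        using RM_sum_near_hull[OF g R p] by simp
      moreover have "hausdorff (convex hull ?S) I \<le> \<epsilon> / 2"
        using \<eta>(2)[OF p] m \<epsilon> I(2) by (intro hausdorff_le_if_support hull I(1)) auto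
      moreover have "hausdorff ?S I \<le> hausdorff ?S (convex hull ?S) + hausdorff (convex hull ?S) I"
        by (intro hausdorff_triangle S convex_compactsD(1)[OF hull] convex_compactsD(1)[OF I(1)])
      ultimately show ?thesis by linarith
    qed
    with \<eta>(1) \<rho> show "\<exists>\<eta>>0. \<forall>N t \<xi>. tagged_partition N t \<xi> \<and> mesh N t < \<eta> \<longrightarrow>
        hausdorff (RM_sum g N t \<xi>) I < \<epsilon>"
      by (intro exI[of _ "min \<eta> \<rho>"]) auto
  qed
  then have "RM_integral g = I"
    by (intro RM_integral_eqI g)
  then show "RM_integral g \<in> convex_compacts"
    and "\<And>u. norm u = 1 \<Longrightarrow> support (RM_integral g) u = integral {0..1} (\<lambda>s. support (g s) u)"
    using I by (auto simp: H_def)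
qed

section \<open>Classes given by a modulus of continuity, and nearest nodes\<close>

lemma modulus_of_continuityD:
  assumes "modulus_of_continuity \<omega>"
  shows "continuous_on {0..} \<omega>" "\<omega> 0 = 0" "\<And>s. 0 \<le> s \<Longrightarrow> 0 \<le> \<omega> s"
    and "\<And>s t. 0 \<le> s \<Longrightarrow> s \<le> t \<Longrightarrow> \<omega> s \<le> \<omega> t"
    and "\<And>s t. 0 \<le> s \<Longrightarrow> 0 \<le> t \<Longrightarrow> \<omega> (s + t) \<le> \<omega> s + \<omega> t"
  using assms by (auto simp: modulus_of_continuity_def mono_on_def image_subset_iff)

lemma modulus_small:
  assumes "modulus_of_continuity \<omega>" "\<epsilon> > 0"
  obtains \<eta> where "\<eta> > 0" "\<And>r. 0 \<le> r \<Longrightarrow> r < \<eta> \<Longrightarrow> \<omega> r < \<epsilon>"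
proof -
  note \<omega> = modulus_of_continuityD[OF assms(1)]
  obtain \<eta> where \<eta>: "\<eta> > 0" "\<forall>r\<in>{0..}. dist r 0 < \<eta> \<longrightarrow> dist (\<omega> r) (\<omega> 0) < \<epsilon>"
    using \<omega>(1) assms(2) unfolding continuous_on_iff by (metis atLeast_iff order_refl)
  show ?thesis
    by (rule that[OF \<eta>(1)]) (use \<eta>(2) \<omega>(2) in \<open>fastforce simp: dist_real_def\<close>)
qed

lemma modulus_abs_diff_le:
  assumes "modulus_of_continuity \<omega>" "0 \<le> a" "0 \<le> b" "\<bar>a - b\<bar> \<le> r"
  shows "\<bar>\<omega> a - \<omega> b\<bar> \<le> \<omega> r"
proof -
  note \<omega> = modulus_of_continuityD[OF assms(1)]
  have "\<omega> c - \<omega> d \<le> \<omega> r" if "0 \<le> c" "0 \<le> d" "\<bar>c - d\<bar> \<le> r" for c d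
  proof -
    have "\<omega> c \<le> \<omega> (d + r)" using that by (intro \<omega>(4)) auto
    also have "\<dots> \<le> \<omega> d + \<omega> r" using that by (intro \<omega>(5)) auto
    finally show ?thesis by simp
  qed
  from this[of a b] this[of b a] assms show ?thesis by (simp add: abs_le_iff abs_minus_commute)
qed

text \<open>A continuous function that is negative somewhere on the unit interval is negative on a set of
  positive measure.\<close>

lemma nonneg_if_AE_nonneg:
  fixes P :: "real \<Rightarrow> real"
  assumes "continuous_on {0..1} P" "AE s in lebesgue_on {0..1}. P s \<ge> 0" "s \<in> {0..1}"
  shows "P s \<ge> 0"
proof -
  define C where "C = {s \<in> {0..1}. P s \<ge> 0}"
  have "C = {0..1} \<inter> P -` {0..}"
    by (auto simp: C_def)
  then have closed: "closed C"
    using continuous_closed_preimage[OF assms(1) closed_atLeastAtMost closed_atLeast[of 0]] by simp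
  have "AE s \<in> {0<..<1} in lebesgue. s \<in> C"
    using assms(2) by (auto simp: AE_restrict_space_iff C_def elim!: eventually_mono)
  \<comment> \<open>first the open interval, where full measure implies density, and then its endpoints\<close>
  from mem_closed_if_AE_lebesgue_open[OF open_greaterThanLessThan closed this]
  have "{0<..<1} \<subseteq> C" by blast
  then have "closure {0<..<1} \<subseteq> C"
    using closed by (rule closure_minimal)
  then have "s \<in> C" using assms(3) by auto
  then show ?thesis by (simp add: C_def)
qed

lemma H_classD:
  assumes "f \<in> H_class \<omega>" "s \<in> {0..1}"
  shows "f s \<in> compacts" and "\<And>s'. s' \<in> {0..1} \<Longrightarrow> hausdorff (f s) (f s') \<le> \<omega> \<bar>s - s'\<bar>"
  using assms by (auto simp: H_class_def)

lemma H_class_support: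
  assumes f: "f \<in> H_class \<omega>" and s: "s \<in> {0..1}" "s' \<in> {0..1}" and u: "norm u = 1"
  shows "\<bar>support (f s) u - support (f s') u\<bar> \<le> \<omega> \<bar>s - s'\<bar>"
  using abs_support_diff_le[OF H_classD(1)[OF f s(1)] H_classD(1)[OF f s(2)] u]
    H_classD(2)[OF f s] by linarith

lemma continuous_on_H_class_support:
  assumes \<omega>: "modulus_of_continuity \<omega>" and f: "f \<in> H_class \<omega>" and u: "norm u = 1"
  shows "continuous_on {0..1} (\<lambda>s. support (f s) u)"
  unfolding continuous_on_iff
proof (intro ballI allI impI)
  fix s e :: real assume s: "s \<in> {0..1}" and "e > 0"
  then obtain \<eta> where \<eta>: "\<eta> > 0" "\<And>r. 0 \<le> r \<Longrightarrow> r < \<eta> \<Longrightarrow> \<omega> r < e"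
    using modulus_small[OF \<omega>] by metis
  have "\<bar>support (f s') u - support (f s) u\<bar> < e" if "s' \<in> {0..1}" "\<bar>s' - s\<bar> < \<eta>" for s'
    using H_class_support[OF f that(1) s u] \<eta>(2)[of "\<bar>s' - s\<bar>"] that(2) by simp
  with \<eta>(1) show "\<exists>d>0. \<forall>s'\<in>{0..1}. dist s' s < d \<longrightarrow>
      dist (support (f s') u) (support (f s) u) < e"
    by (auto simp: dist_real_def)
qed

text \<open>
  For \<open>f\<close> in the class, \<open>P f\<close> is bounded and its support functions are equicontinuous, because \<open>P\<close>
  is uniformly continuous and \<open>\<omega>\<close> is small near zero.
\<close>

lemma weighted_integral_support:
  fixes f :: "real \<Rightarrow> 'a::euclidean_space set"
  assumes P: "continuous_on {0..1} P" "\<forall>s\<in>{0..1}. P s \<ge> 0"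
    and \<omega>: "modulus_of_continuity \<omega>" and f: "f \<in> H_class \<omega>"
  defines "J \<equiv> RM_integral (\<lambda>s. P s \<bullet>\<^sub>S f s)"
  shows "J \<in> convex_compacts"
    and "\<And>u. norm u = 1 \<Longrightarrow> support J u = integral {0..1} (\<lambda>s. P s * support (f s) u)"
proof -
  note \<omega>D = modulus_of_continuityD[OF \<omega>]
  obtain R0 where R0: "\<And>a. a \<in> f 0 \<Longrightarrow> norm a \<le> R0"
    using H_classD(1)[OF f, of 0] compact_imp_bounded[of "f 0"]
    by (auto simp: compacts_iff bounded_iff)
  define R where "R = \<bar>R0\<bar> + \<omega> 1"
  have R_nonneg: "R \<ge> 0" using \<omega>D(3)[of 1] by (simp add: R_def)
  have R: "f s \<subseteq> cball 0 R" if s: "s \<in> {0..1}" for s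
  proof
    fix b assume b: "b \<in> f s"
    then obtain a where a: "a \<in> f 0" "dist b a \<le> hausdorff (f s) (f 0)"
      using hausdorff_nearest[of "f s" "f 0" b] H_classD(1)[OF f] s by auto
    have "hausdorff (f s) (f 0) \<le> \<omega> 1"
      using H_classD(2)[OF f s, of 0] \<omega>D(4)[of s 1] s by auto
    moreover have "norm b \<le> norm a + dist b a"
      using norm_triangle_ineq[of a "b - a"] by (simp add: dist_norm)
    ultimately show "b \<in> cball 0 R"
      using a R0[OF a(1)] by (simp add: R_def)
  qed
  have "compact (P ` {0..1})" using P(1) by (intro compact_continuous_image) auto
  then obtain M where M: "M > 0" "\<And>s. s \<in> {0..1} \<Longrightarrow> \<bar>P s\<bar> \<le> M"
    by (auto simp: bounded_pos dest!: compact_imp_bounded)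
  have sup: "support (P s \<bullet>\<^sub>S f s) u = P s * support (f s) u" if "s \<in> {0..1}" for s u
    using support_scale H_classD(1)[OF f] P(2) that by blast
  have 1: "P s \<bullet>\<^sub>S f s \<in> compacts" if "s \<in> {0..1}" for s
    using compacts_scale H_classD(1)[OF f] that by blast
  have 2: "P s \<bullet>\<^sub>S f s \<subseteq> cball 0 (M * R)" if s: "s \<in> {0..1}" for s
  proof
    fix b assume "b \<in> P s \<bullet>\<^sub>S f s"
    then obtain a where a: "a \<in> f s" "b = P s *\<^sub>R a" by (auto simp: set_scale_def)
    have "norm a \<le> R" using R[OF s] a(1) by auto
    then have "\<bar>P s\<bar> * norm a \<le> M * R"
      using M s by (intro mult_mono) auto
    with a(2) show "b \<in> cball 0 (M * R)" by simp
  qed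
  have 3: "\<exists>\<eta>>0. \<forall>s\<in>{0..1}. \<forall>s'\<in>{0..1}. \<bar>s - s'\<bar> < \<eta> \<longrightarrow>
      (\<forall>u. norm u = 1 \<longrightarrow> \<bar>support (P s \<bullet>\<^sub>S f s) u - support (P s' \<bullet>\<^sub>S f s') u\<bar> \<le> \<epsilon>)"
    if \<epsilon>: "\<epsilon> > 0" for \<epsilon>
  proof -
    have "uniformly_continuous_on {0..1} P"
      using P(1) compact_uniformly_continuous by blast
    moreover have "\<epsilon> / (2 * (R + 1)) > 0" using \<epsilon> R_nonneg by simp
    ultimately obtain \<eta>1 where \<eta>1: "\<eta>1 > 0" "\<And>s s'. s \<in> {0..1} \<Longrightarrow> s' \<in> {0..1} \<Longrightarrow>
        \<bar>s - s'\<bar> < \<eta>1 \<Longrightarrow> \<bar>P s - P s'\<bar> < \<epsilon> / (2 * (R + 1))"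
      unfolding uniformly_continuous_on_def dist_real_def by metis
    obtain \<eta>2 where \<eta>2: "\<eta>2 > 0" "\<And>r. 0 \<le> r \<Longrightarrow> r < \<eta>2 \<Longrightarrow> \<omega> r < \<epsilon> / (2 * M)"
      using modulus_small[OF \<omega>, of "\<epsilon> / (2 * M)"] \<epsilon> M(1) by auto
    have "\<bar>support (P s \<bullet>\<^sub>S f s) u - support (P s' \<bullet>\<^sub>S f s') u\<bar> \<le> \<epsilon>"
      if s: "s \<in> {0..1}" "s' \<in> {0..1}" and d: "\<bar>s - s'\<bar> < min \<eta>1 \<eta>2" and u: "norm u = 1" for s s' u
    proof -
      let ?h = "\<lambda>s. support (f s) u"
      have "\<bar>?h s - ?h s'\<bar> \<le> \<epsilon> / (2 * M)"
        using H_class_support[OF f s u] \<eta>2(2)[of "\<bar>s - s'\<bar>"] d by auto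
      then have "\<bar>P s\<bar> * \<bar>?h s - ?h s'\<bar> \<le> M * (\<epsilon> / (2 * M))"
        using M s by (intro mult_mono) auto
      moreover have "\<bar>P s - P s'\<bar> * \<bar>?h s'\<bar> \<le> \<epsilon> / (2 * (R + 1)) * R"
        using \<eta>1(2)[OF s] d abs_support_le[OF H_classD(1)[OF f s(2)] R[OF s(2)] u] \<epsilon> R_nonneg
        by (intro mult_mono) auto
      moreover have "\<epsilon> / (2 * (R + 1)) * R \<le> \<epsilon> / 2"
        using \<epsilon> R_nonneg by (simp add: field_simps)
      moreover have "M * (\<epsilon> / (2 * M)) = \<epsilon> / 2"
        using M(1) by simp
      moreover have "P s * ?h s - P s' * ?h s' = P s * (?h s - ?h s') + (P s - P s') * ?h s'"
        by (simp add: algebra_simps)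
      then have "\<bar>P s * ?h s - P s' * ?h s'\<bar> \<le> \<bar>P s\<bar> * \<bar>?h s - ?h s'\<bar> + \<bar>P s - P s'\<bar> * \<bar>?h s'\<bar>"
        by (metis abs_mult abs_triangle_ineq)
      ultimately have "\<bar>P s * ?h s - P s' * ?h s'\<bar> \<le> \<epsilon>"
        by linarith
      then show ?thesis
        using sup s by simp
    qed
    with \<eta>1(1) \<eta>2(1) show ?thesis
      by (intro exI[of _ "min \<eta>1 \<eta>2"]) auto
  qed
  show "J \<in> convex_compacts"
    unfolding J_def by (rule RM_integral_support(1)[where R = "M * R"]) (fact 1 2 3)+
  show "support J u = integral {0..1} (\<lambda>s. P s * support (f s) u)" if "norm u = 1" for u
  proof -
    have "support J u = integral {0..1} (\<lambda>s. support (P s \<bullet>\<^sub>S f s) u)"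
      unfolding J_def
      by (rule RM_integral_support(2)[where R = "M * R"]) (fact 1 2 3 that)+
    also have "\<dots> = integral {0..1} (\<lambda>s. P s * support (f s) u)"
      using sup by (intro Henstock_Kurzweil_Integration.integral_cong) auto
    finally show ?thesis .
  qed
qed

lemma node_dist_le: "j \<in> {1..n} \<Longrightarrow> node_dist n x s \<le> \<bar>s - x j\<bar>"
  unfolding node_dist_def by (intro Min_le) auto

lemma node_dist_attained:
  assumes "n \<ge> 1"
  obtains j where "j \<in> {1..n}" "node_dist n x s = \<bar>s - x j\<bar>"
proof -
  have "node_dist n x s \<in> (\<lambda>j. \<bar>s - x j\<bar>) ` {1..n}"
    unfolding node_dist_def using assms by (intro Min_in) auto
  with that show ?thesis by auto
qed

lemma node_dist_nonneg: "n \<ge> 1 \<Longrightarrow> 0 \<le> node_dist n x s"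
  using node_dist_attained[of n x s] by (metis abs_ge_zero)

lemma node_dist_node:
  assumes "n \<ge> 1" "j \<in> {1..n}"
  shows "node_dist n x (x j) = 0"
  using node_dist_le[OF assms(2), of x "x j"] node_dist_nonneg[OF assms(1), of x "x j"] by simp

lemma node_dist_Lipschitz:
  assumes "n \<ge> 1"
  shows "\<bar>node_dist n x s - node_dist n x s'\<bar> \<le> \<bar>s - s'\<bar>"
proof -
  have "node_dist n x a - node_dist n x b \<le> \<bar>a - b\<bar>" for a b
  proof -
    obtain j where "j \<in> {1..n}" "node_dist n x b = \<bar>b - x j\<bar>"
      using node_dist_attained[OF assms] by metis
    then show ?thesis using node_dist_le[of j n x a] by auto
  qed
  from this[of s s'] this[of s' s] show ?thesis by auto
qed

lemma continuous_on_node_dist: "n \<ge> 1 \<Longrightarrow> continuous_on S (node_dist n x)"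
  unfolding continuous_on_iff dist_real_def
  using node_dist_Lipschitz[of n x] by (meson le_less_trans)

lemma continuous_on_modulus_node_dist:
  assumes "n \<ge> 1" "modulus_of_continuity \<omega>"
  shows "continuous_on S (\<lambda>s. \<omega> (node_dist n x s))"
  by (rule continuous_on_compose2[OF modulus_of_continuityD(1)[OF assms(2)]
        continuous_on_node_dist[OF assms(1)]]) (use node_dist_nonneg[OF assms(1)] in auto)

lemma closed_cell: "n \<ge> 1 \<Longrightarrow> closed (cell n x i)"
proof -
  assume n: "n \<ge> 1"
  have "closed {s. node_dist n x s = \<bar>s - x i\<bar>}"
    by (intro closed_Collect_eq continuous_on_node_dist n continuous_intros)
  then have "closed ({0..1} \<inter> {s. node_dist n x s = \<bar>s - x i\<bar>})"
    by (intro closed_Int closed_atLeastAtMost)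
  then show ?thesis by (simp add: cell_def Int_def)
qed

lemma integrable_on_cell:
  fixes \<phi> :: "real \<Rightarrow> real"
  assumes "n \<ge> 1" "continuous_on {0..1} \<phi>"
  shows "\<phi> integrable_on cell n x i"
proof -
  have "\<phi> absolutely_integrable_on {0..1}"
    using assms(2) by (rule absolutely_integrable_continuous_real)
  then have "\<phi> absolutely_integrable_on cell n x i"
    by (rule set_integrable_subset)
      (use closed_cell[OF assms(1)] in \<open>auto simp: cell_def intro: sets_completionI_sets\<close>)
  then show ?thesis by (simp add: absolutely_integrable_on_def)
qed

text \<open>Two cells meet at most in the midpoint of their nodes.\<close>

lemma integral_cells:
  fixes \<phi> :: "real \<Rightarrow> real"
  assumes n: "n \<ge> 1" and x: "inj_on x {1..n}" and \<phi>: "continuous_on {0..1} \<phi>"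
  shows "(\<Sum>k\<in>{1..n}. integral (cell n x k) \<phi>) = integral {0..1} \<phi>"
proof -
  have "(\<phi> has_integral (\<Sum>k\<in>{1..n}. integral (cell n x k) \<phi>)) (\<Union>k\<in>{1..n}. cell n x k)"
  proof (rule has_integral_UN)
    show "(\<phi> has_integral integral (cell n x k) \<phi>) (cell n x k)" for k
      using integrable_on_cell[OF n \<phi>] by (rule integrable_integral)
    show "pairwise (\<lambda>i j. negligible (cell n x i \<inter> cell n x j)) {1..n}"
    proof (rule pairwiseI)
      fix i j assume "i \<in> {1..n}" "j \<in> {1..n}" "i \<noteq> j"
      then have "x i \<noteq> x j" using x by (auto dest: inj_onD)
      then have "cell n x i \<inter> cell n x j \<subseteq> {(x i + x j) / 2}"
        by (auto simp: cell_def abs_if split: if_splits)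
      then show "negligible (cell n x i \<inter> cell n x j)"
        by (rule negligible_subset[OF negligible_finite, rotated]) simp
    qed
  qed simp
  moreover have "(\<Union>k\<in>{1..n}. cell n x k) = {0..1}"
  proof
    show "{0..1} \<subseteq> (\<Union>k\<in>{1..n}. cell n x k)"
    proof
      fix s :: real assume "s \<in> {0..1}"
      moreover obtain j where "j \<in> {1..n}" "node_dist n x s = \<bar>s - x j\<bar>"
        using node_dist_attained[OF n] by metis
      ultimately show "s \<in> (\<Union>k\<in>{1..n}. cell n x k)" by (auto simp: cell_def)
    qed
  qed (auto simp: cell_def)
  ultimately show ?thesis by (metis integral_unique)
qed

section \<open>The error of the cell method, and its optimality\<close>

lemma cell_weight_nonneg:
  assumes "n \<ge> 1" "continuous_on {0..1} P" "\<forall>s\<in>{0..1}. P s \<ge> 0"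
  shows "cell_weight P n x k \<ge> 0"
  unfolding cell_weight_def using assms
  by (intro Henstock_Kurzweil_Integration.integral_nonneg integrable_on_cell)
    (auto simp: cell_def)

lemma cell_method_mem:
  fixes A :: "nat \<Rightarrow> 'a::euclidean_space set"
  assumes "\<And>k. k \<in> {1..n} \<Longrightarrow> A k \<in> compacts"
  shows "cell_method P n x A \<in> convex_compacts"
  unfolding cell_method_def using assms
  by (intro convex_compacts_hull compacts_sum compacts_scale)

lemma cell_method_support:
  fixes A :: "nat \<Rightarrow> 'a::euclidean_space set"
  assumes "n \<ge> 1" "continuous_on {0..1} P" "\<forall>s\<in>{0..1}. P s \<ge> 0"
    and "\<And>k. k \<in> {1..n} \<Longrightarrow> A k \<in> compacts"
  shows "support (cell_method P n x A) u = (\<Sum>k\<in>{1..n}. cell_weight P n x k * support (A k) u)"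
proof -
  have "support (cell_method P n x A) u = support (\<Sum>k\<in>{1..n}. cell_weight P n x k \<bullet>\<^sub>S A k) u"
    unfolding cell_method_def by (intro support_hull compacts_sum compacts_scale assms(4))
  also have "\<dots> = (\<Sum>k\<in>{1..n}. support (cell_weight P n x k \<bullet>\<^sub>S A k) u)"
    by (intro support_sum compacts_scale assms(4))
  also have "\<dots> = (\<Sum>k\<in>{1..n}. cell_weight P n x k * support (A k) u)"
    by (intro sum.cong refl support_scale assms(4) cell_weight_nonneg assms(1-3))
  finally show ?thesis .
qed

text \<open>
  On the \<open>k\<close>-th cell the nearest node is \<open>x\<^sub>k\<close>, so there the support functions of \<open>f s\<close> and \<open>f (x k)\<close>
  differ by at most \<open>\<omega> (node_dist n x s)\<close> on the unit sphere.
\<close>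

lemma cell_method_error_le:
  fixes f :: "real \<Rightarrow> 'a::euclidean_space set"
  assumes n: "n \<ge> 1" and P: "continuous_on {0..1} P" "\<forall>s\<in>{0..1}. P s \<ge> 0"
    and \<omega>: "modulus_of_continuity \<omega>" and x: "inj_on x {1..n}" "x ` {1..n} \<subseteq> {0..1}"
    and f: "f \<in> H_class \<omega>"
  shows "hausdorff (RM_integral (\<lambda>s. P s \<bullet>\<^sub>S f s)) (cell_method P n x (\<lambda>i\<in>{1..n}. f (x i)))
    \<le> integral {0..1} (\<lambda>s. P s * \<omega> (node_dist n x s))" (is "_ \<le> ?E")
proof (rule hausdorff_le_if_support)
  note J = weighted_integral_support[OF P \<omega> f]
  have fx: "f (x k) \<in> compacts" if "k \<in> {1..n}" for k
    using H_classD(1)[OF f] x(2) that by (metis image_subset_iff)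
  show "RM_integral (\<lambda>s. P s \<bullet>\<^sub>S f s) \<in> convex_compacts" by (rule J(1))
  show "cell_method P n x (\<lambda>i\<in>{1..n}. f (x i)) \<in> convex_compacts"
    using fx by (intro cell_method_mem) auto
  have contE: "continuous_on {0..1} (\<lambda>s. P s * \<omega> (node_dist n x s))"
    by (intro continuous_intros P continuous_on_modulus_node_dist n \<omega>)
  show "?E \<ge> 0"
    using P(2) modulus_of_continuityD(3)[OF \<omega>] node_dist_nonneg[OF n]
    by (intro Henstock_Kurzweil_Integration.integral_nonneg integrable_continuous_real contE) auto
  fix u :: 'a assume u: "norm u = 1"
  let ?h = "\<lambda>s. support (f s) u"
  have conth: "continuous_on {0..1} (\<lambda>s. P s * ?h s)"
    by (intro continuous_intros P continuous_on_H_class_support[OF \<omega> f u])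
  have "support (cell_method P n x (\<lambda>i\<in>{1..n}. f (x i))) u =
      (\<Sum>k\<in>{1..n}. cell_weight P n x k * ?h (x k))"
    using fx by (subst cell_method_support[OF n P]) auto
  also have "\<dots> = (\<Sum>k\<in>{1..n}. integral (cell n x k) (\<lambda>s. P s * ?h (x k)))"
    by (simp add: cell_weight_def)
  finally have "support (RM_integral (\<lambda>s. P s \<bullet>\<^sub>S f s)) u -
      support (cell_method P n x (\<lambda>i\<in>{1..n}. f (x i))) u =
      (\<Sum>k\<in>{1..n}. integral (cell n x k) (\<lambda>s. P s * ?h s)
        - integral (cell n x k) (\<lambda>s. P s * ?h (x k)))"
    by (simp only: J(2)[OF u] sum_subtractf integral_cells[OF n x(1) conth])
  also have "\<bar>\<dots>\<bar> \<le> (\<Sum>k\<in>{1..n}. integral (cell n x k) (\<lambda>s. P s * \<omega> (node_dist n x s)))"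
  proof (rule order_trans[OF sum_abs sum_mono])
    fix k assume k: "k \<in> {1..n}"
    have contk: "continuous_on {0..1} (\<lambda>s. P s * ?h (x k))"
      by (intro continuous_intros P)
    have "\<bar>integral (cell n x k) (\<lambda>s. P s * ?h s - P s * ?h (x k))\<bar>
        \<le> integral (cell n x k) (\<lambda>s. P s * \<omega> (node_dist n x s))"
    proof (rule Henstock_Kurzweil_Integration.integral_norm_bound_integral
        [of "\<lambda>s. P s * ?h s - P s * ?h (x k)", unfolded real_norm_def])
      fix s assume s: "s \<in> cell n x k"
      then have "s \<in> {0..1}" "node_dist n x s = \<bar>s - x k\<bar>" by (auto simp: cell_def)
      moreover have "x k \<in> {0..1}" using x(2) k by (metis image_subset_iff)
      ultimately have "\<bar>?h s - ?h (x k)\<bar> \<le> \<omega> (node_dist n x s)" "P s \<ge> 0"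
        using H_class_support[OF f _ _ u, of s "x k"] P(2) by auto
      then have "P s * \<bar>?h s - ?h (x k)\<bar> \<le> P s * \<omega> (node_dist n x s)"
        by (rule mult_left_mono)
      with \<open>P s \<ge> 0\<close> show "\<bar>P s * ?h s - P s * ?h (x k)\<bar> \<le> P s * \<omega> (node_dist n x s)"
        by (simp add: abs_mult flip: right_diff_distrib)
    qed (intro integrable_on_cell n continuous_on_diff conth contk contE)+
    then show "\<bar>integral (cell n x k) (\<lambda>s. P s * ?h s) - integral (cell n x k) (\<lambda>s. P s * ?h (x k))\<bar>
        \<le> integral (cell n x k) (\<lambda>s. P s * \<omega> (node_dist n x s))"
      by (simp only: Henstock_Kurzweil_Integration.integral_diff integrable_on_cell n conth contk)
  qed
  also have "\<dots> = ?E"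
    by (rule integral_cells[OF n x(1) contE])
  finally show "\<bar>support (RM_integral (\<lambda>s. P s \<bullet>\<^sub>S f s)) u -
      support (cell_method P n x (\<lambda>i\<in>{1..n}. f (x i))) u\<bar> \<le> ?E" .
qed

lemma hausdorff_singletons:
  fixes a b :: "'a::euclidean_space"
  shows "hausdorff {a} {b} = dist a b"
  by (simp add: hausdorff_def excess_def dist_commute)

lemma singleton_mem_H_class:
  fixes e :: "'a::euclidean_space"
  assumes n: "n \<ge> 1" and \<omega>: "modulus_of_continuity \<omega>" and e: "norm e = 1"
  shows "(\<lambda>s. {\<omega> (node_dist n x s) *\<^sub>R e}) \<in> H_class \<omega>"
proof -
  have "\<bar>\<omega> (node_dist n x s) - \<omega> (node_dist n x s')\<bar> \<le> \<omega> \<bar>s - s'\<bar>" for s s'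
    using node_dist_nonneg[OF n] node_dist_Lipschitz[OF n] by (intro modulus_abs_diff_le[OF \<omega>])
  then show ?thesis
    using e by (auto simp: H_class_def compacts_iff hausdorff_singletons dist_norm
        simp flip: scaleR_left_diff_distrib)
qed

text \<open>
  The singleton-valued functions \<open>{\<plusminus>\<omega> (node_dist n x s) e}\<close> carry the same information
  \<open>{0}, \<dots>, {0}\<close>, while the support functions of their integrals at \<open>e\<close> differ by twice the
  asserted error.  So no single approximation is closer than the asserted error to both integrals.
\<close>

lemma recovery_error_ge:
  fixes \<Phi> :: "(nat \<Rightarrow> 'a::euclidean_space set) \<Rightarrow> 'a set"
  assumes n: "n \<ge> 1" and P: "continuous_on {0..1} P" "\<forall>s\<in>{0..1}. P s \<ge> 0"
    and \<omega>: "modulus_of_continuity \<omega>" and \<Phi>: "\<Phi> \<in> methods n"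
  shows "ereal (integral {0..1} (\<lambda>s. P s * \<omega> (node_dist n x s)))
    \<le> recovery_error P (H_class \<omega>) n x \<Phi>" (is "ereal ?E \<le> _")
proof -
  obtain e :: 'a where e: "norm e = 1"
    using norm_Basis nonempty_Basis by blast
  define F where "F v s = {\<omega> (node_dist n x s) *\<^sub>R v}" for v :: 'a and s
  define C where "C = \<Phi> (\<lambda>i\<in>{1..n}. {0})"
  have "C \<in> convex_compacts"
    using \<Phi> unfolding C_def methods_def by (rule funcset_mem) (auto simp: compacts_iff)
  then have C: "C \<in> compacts" by (rule convex_compactsD)
  have F: "F v \<in> H_class \<omega>" if "norm v = 1" for v
    using singleton_mem_H_class[OF n \<omega> that] by (simp add: F_def[abs_def])
  have info: "(\<lambda>i\<in>{1..n}. F v (x i)) = (\<lambda>i\<in>{1..n}. {0})" for v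
    using node_dist_node[OF n] modulus_of_continuityD(2)[OF \<omega>] by (intro restrict_ext) (simp add: F_def)
  have bound: "\<bar>(e \<bullet> v) * ?E - support C e\<bar> \<le> r"
    if v: "norm v = 1" and r: "recovery_error P (H_class \<omega>) n x \<Phi> \<le> ereal r" for v r
  proof -
    let ?J = "RM_integral (\<lambda>s. P s \<bullet>\<^sub>S F v s)"
    note J = weighted_integral_support[OF P \<omega> F[OF v]]
    have "support ?J e = integral {0..1} (\<lambda>s. (e \<bullet> v) * (P s * \<omega> (node_dist n x s)))"
      unfolding J(2)[OF e] by (simp only: F_def support_singleton inner_scaleR_right mult_ac)
    also have "\<dots> = (e \<bullet> v) * ?E"
      by (rule integral_mult_right)
    finally have "\<bar>(e \<bullet> v) * ?E - support C e\<bar> \<le> hausdorff ?J C"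
      using abs_support_diff_le[OF convex_compactsD(1)[OF J(1)] C e] by simp
    moreover have "ereal (hausdorff ?J (\<Phi> (\<lambda>i\<in>{1..n}. F v (x i)))) \<le> recovery_error P (H_class \<omega>) n x \<Phi>"
      unfolding recovery_error_def by (rule SUP_upper[OF F[OF v]])
    then have "ereal (hausdorff ?J (\<Phi> (\<lambda>i\<in>{1..n}. F v (x i)))) \<le> ereal r"
      using r by (rule order_trans)
    then have "hausdorff ?J C \<le> r"
      by (simp only: info C_def ereal_less_eq)
    ultimately show ?thesis by linarith
  qed
  show ?thesis
  proof (rule ccontr)
    assume "\<not> ?thesis"
    then have "recovery_error P (H_class \<omega>) n x \<Phi> < ereal ?E"
      by (simp only: not_le)
    then obtain r where "recovery_error P (H_class \<omega>) n x \<Phi> < ereal r" "ereal r < ereal ?E"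
      using ereal_dense2 by blast
    then have r: "recovery_error P (H_class \<omega>) n x \<Phi> \<le> ereal r" "r < ?E"
      by simp_all
    have "e \<bullet> e = 1" using e by (simp add: dot_square_norm)
    \<comment> \<open>the number \<open>h\<^sub>C e\<close> would be within \<open>r < E\<close> of both \<open>E\<close> and \<open>-E\<close>\<close>
    with bound[of e r] bound[of "- e" r] e r show False
      by (auto simp: abs_le_iff)
  qed
qed

theorem theorem1:
  fixes n :: nat and P \<omega> :: "real \<Rightarrow> real" and x :: "nat \<Rightarrow> real"
  assumes "n \<ge> 1"
    and "continuous_on {0..1} P"
    and "AE s in lebesgue_on {0..1}. P s \<ge> 0"
    and "modulus_of_continuity \<omega>"
    and "strict_mono_on {1..n} x"
    and "x ` {1..n} \<subseteq> {0..1}"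
  shows "optimal_method P (H_class \<omega> :: (real \<Rightarrow> (real ^ 'm) set) set) n x (cell_method P n x) \<and>
    optimal_error P (H_class \<omega> :: (real \<Rightarrow> (real ^ 'm) set) set) n x =
      ereal (integral {0..1} (\<lambda>s. P s * \<omega> (node_dist n x s)))"
proof -
  let ?M = "H_class \<omega> :: (real \<Rightarrow> (real ^ 'm) set) set"
  let ?E = "ereal (integral {0..1} (\<lambda>s. P s * \<omega> (node_dist n x s)))"
  have P: "\<forall>s\<in>{0..1}. P s \<ge> 0"
    using nonneg_if_AE_nonneg[OF assms(2,3)] by blast
  have inj: "inj_on x {1..n}"
    using assms(5) by (rule strict_mono_on_imp_inj_on)
  have admissible: "cell_method P n x \<in> (methods n :: ((nat \<Rightarrow> (real ^ 'm) set) \<Rightarrow> (real ^ 'm) set) set)"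
    unfolding methods_def by (intro funcsetI cell_method_mem) (auto simp: PiE_def)
  have lower: "?E \<le> recovery_error P ?M n x \<Phi>" if "\<Phi> \<in> methods n" for \<Phi>
    using recovery_error_ge[OF assms(1,2) P assms(4) that] .
  have upper: "recovery_error P ?M n x (cell_method P n x) \<le> ?E"
    unfolding recovery_error_def
    using cell_method_error_le[OF assms(1,2) P assms(4) inj assms(6)] by (intro SUP_least) simp
  have error: "optimal_error P ?M n x = ?E"
    unfolding optimal_error_def
  proof (rule antisym)
    show "(INF \<Phi>\<in>methods n. recovery_error P ?M n x \<Phi>) \<le> ?E"
      by (rule INF_lower2[OF admissible]) (rule upper)
    show "?E \<le> (INF \<Phi>\<in>methods n. recovery_error P ?M n x \<Phi>)"
      using lower by (rule INF_greatest)
  qed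
  moreover have "recovery_error P ?M n x (cell_method P n x) = ?E"
    using upper lower[OF admissible] by (rule antisym)
  ultimately show ?thesis
    using admissible by (simp add: optimal_method_def)
qed

end
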